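(* Let $d\ge1$, $p\in[1,\infty)$ and $\alpha\ge 2p/d$. There exists a function $f:[0,1)\times\mathbb R^d\to[0,\infty)$, supported in $[0,1)\times B_1$ (i.e. $f(t,x)=0$ whenever $|x|\ge1$), such that $\|f(t,\cdot)\|_{L^p(\mathbb R^d)}$ is constant in time and $$ f_t\le\Delta f+f^{1+\alpha}\qquad\text{on }[0,1)\times\mathbb R^d $$ in the classical sense, and yet $f(t,0)\to+\infty$ as $t\to1$.
   Context: $B_1$ is the unit ball of $\mathbb R^d$ centred at the origin. "In the classical sense" means that $f$ is smooth on $[0,1)\times\mathbb R^d$ and the inequality holds pointwise. *)

theory Defs
  imports "HOL-Analysis.Analysis"
begin

text \<open>
  Derivatives are taken within \<open>S\<close>, so that on \<open>{0..<1} \<times> UNIV\<close> smoothness includes the initial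
  time, where time derivatives are one-sided. The derivative \<open>F'\<close> is uniquely determined whenever
  \<open>S\<close> is, as there, convex with nonempty interior.
\<close>

primrec C_k_on :: "nat \<Rightarrow> 'a::real_normed_vector set \<Rightarrow> ('a \<Rightarrow> 'b::real_normed_vector) \<Rightarrow> bool" where
  "C_k_on 0 S F \<longleftrightarrow> continuous_on S F"
| "C_k_on (Suc k) S F \<longleftrightarrow>
     (\<exists>F'. (\<forall>x\<in>S. (F has_derivative F' x) (at x within S)) \<and>
           (\<forall>v. C_k_on k S (\<lambda>x. F' x v)))"

definition smooth_on :: "'a::real_normed_vector set \<Rightarrow> ('a \<Rightarrow> 'b::real_normed_vector) \<Rightarrow> bool" where
  "smooth_on S F \<longleftrightarrow> (\<forall>k. C_k_on k S F)"

definition partial_deriv :: "'n::finite \<Rightarrow> (real ^ 'n \<Rightarrow> real) \<Rightarrow> real ^ 'n \<Rightarrow> real" where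
  "partial_deriv i g x = deriv (\<lambda>s. g (x + s *\<^sub>R axis i 1)) 0"

definition laplacian :: "(real ^ 'n::finite \<Rightarrow> real) \<Rightarrow> real ^ 'n \<Rightarrow> real" where
  "laplacian g x = (\<Sum>i\<in>UNIV. partial_deriv i (partial_deriv i g) x)"

text \<open>
  Meaningful only when \<open>\<bar>g x\<bar> powr p\<close> is Lebesgue integrable (the integral is \<open>0\<close> otherwise), as it
  is for continuous \<open>g\<close> of compact support.
\<close>

definition Lp_norm :: "real \<Rightarrow> ('a::euclidean_space \<Rightarrow> real) \<Rightarrow> real" where
  "Lp_norm p g = (LINT x|lborel. \<bar>g x\<bar> powr p) powr (1 / p)"

end

theory Submission
  imports Defs
begin

text \<open>
  The solution is self-similar: \<open>f t x = (1 - t) powr (- d / (2 * p)) * \<phi> (x / sqrt (1 - t))\<close> with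
  \<open>\<phi> y = A * exp (- 1 / (1 - \<bar>y\<bar>\<^sup>2))\<close> in the unit ball. This scaling preserves the \<open>L\<^sup>p\<close> norm, and as
  \<open>\<alpha> \<ge> 2 * p / d\<close> and \<open>1 - t \<le> 1\<close>, the differential inequality reduces to one for the profile \<open>\<phi>\<close>.
  There the drift term is nonpositive because \<open>\<phi>\<close> is radially decreasing, the Laplacian dominates
  \<open>\<phi>\<close> near the unit sphere, and the nonlinearity dominates everything else once \<open>A\<close> is large.
\<close>

section \<open>Closure properties of finite-order smoothness\<close>

lemma C_k_on_SucI:
  assumes "\<And>x. x \<in> S \<Longrightarrow> (F has_derivative F' x) (at x within S)"
    and "\<And>v. C_k_on k S (\<lambda>x. F' x v)"
  shows "C_k_on (Suc k) S F"
  using assms by auto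

lemma C_k_on_const: "C_k_on k S (\<lambda>x. c)"
  by (induction k arbitrary: c) (auto intro!: exI[of _ "\<lambda>x v. 0"])

text \<open>Differentiability gives continuity in the base case; higher orders apply the induction
  hypothesis to the directional derivatives. The product and chain rules need this because
  undifferentiated factors reappear one order lower.\<close>

lemma C_k_on_Suc_D: "C_k_on (Suc k) S F \<Longrightarrow> C_k_on k S F"
proof (induction k arbitrary: F)
  case 0
  then show ?case
    by (auto intro: has_derivative_continuous_on)
next
  case (Suc k)
  from Suc.prems obtain F' where "\<forall>x\<in>S. (F has_derivative F' x) (at x within S)"
    and "\<forall>v. C_k_on (Suc k) S (\<lambda>x. F' x v)"
    by (subst (asm) C_k_on.simps(2)) blast
  with Suc.IH show ?case
    by (auto simp only: C_k_on.simps(2))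
qed

lemma C_k_on_bounded_linear:
  assumes "bounded_linear F"
  shows "C_k_on k S F"
proof (cases k)
  case 0
  then show ?thesis
    using assms by (auto intro: linear_continuous_on)
next
  case (Suc j)
  then show ?thesis
    using bounded_linear_imp_has_derivative[OF assms]
    by (auto intro!: exI[of _ "\<lambda>x. F"] C_k_on_const)
qed

lemma C_k_on_add:
  assumes "C_k_on k S F" "C_k_on k S G"
  shows "C_k_on k S (\<lambda>x. F x + G x)"
  using assms
proof (induction k arbitrary: F G)
  case 0
  then show ?case by (auto intro: continuous_on_add)
next
  case (Suc k)
  obtain F' where F': "\<forall>x\<in>S. (F has_derivative F' x) (at x within S)"
      "\<forall>v. C_k_on k S (\<lambda>x. F' x v)"
    using Suc.prems(1) by auto
  obtain G' where G': "\<forall>x\<in>S. (G has_derivative G' x) (at x within S)"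
      "\<forall>v. C_k_on k S (\<lambda>x. G' x v)"
    using Suc.prems(2) by auto
  show ?case
    by (rule C_k_on_SucI[where F' = "\<lambda>x v. F' x v + G' x v"])
      (intro has_derivative_add Suc.IH F'[rule_format] G'[rule_format]; assumption)+
qed

lemma C_k_on_mult:
  fixes F G :: "'a::real_normed_vector \<Rightarrow> real"
  assumes "C_k_on k S F" "C_k_on k S G"
  shows "C_k_on k S (\<lambda>x. F x * G x)"
  using assms
proof (induction k arbitrary: F G)
  case 0
  then show ?case by (auto intro: continuous_on_mult)
next
  case (Suc k)
  obtain F' where F': "\<forall>x\<in>S. (F has_derivative F' x) (at x within S)"
      "\<forall>v. C_k_on k S (\<lambda>x. F' x v)"
    using Suc.prems(1) by auto
  obtain G' where G': "\<forall>x\<in>S. (G has_derivative G' x) (at x within S)"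
      "\<forall>v. C_k_on k S (\<lambda>x. G' x v)"
    using Suc.prems(2) by auto
  show ?case
  proof (rule C_k_on_SucI)
    show "((\<lambda>x. F x * G x) has_derivative (\<lambda>v. F x * G' x v + F' x v * G x)) (at x within S)"
      if "x \<in> S" for x
      by (intro has_derivative_mult F'[rule_format] G'[rule_format] that)
    show "C_k_on k S (\<lambda>x. F x * G' x v + F' x v * G x)" for v
      by (intro C_k_on_add Suc.IH F'[rule_format] G'[rule_format]
          C_k_on_Suc_D[OF Suc.prems(1)] C_k_on_Suc_D[OF Suc.prems(2)])
  qed
qed

lemma C_k_on_inner_self:
  fixes F :: "'a::real_normed_vector \<Rightarrow> 'b::real_inner"
  assumes "bounded_linear F"
  shows "C_k_on k S (\<lambda>x. F x \<bullet> F x)"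
proof (cases k)
  case 0
  then show ?thesis
    by (simp add: continuous_on_inner linear_continuous_on[OF assms])
next
  case (Suc j)
  have "((\<lambda>x. F x \<bullet> F x) has_derivative (\<lambda>v. 2 * (F x \<bullet> F v))) (at x within S)" for x
    using bounded_linear_imp_has_derivative[OF assms]
    by (auto intro!: derivative_eq_intros simp: inner_commute)
  moreover have "C_k_on j S (\<lambda>x. 2 * (F x \<bullet> F v))" for v
    by (intro C_k_on_bounded_linear bounded_linear_const_mult
        bounded_linear_compose[OF bounded_linear_inner_left assms])
  ultimately show ?thesis
    unfolding Suc by (rule C_k_on_SucI)
qed

text \<open>Differentiation lowers the exponent to \<open>a - 1\<close>, so the induction must cover
  all exponents at once. Positivity of \<open>F\<close> keeps the base away from the singularity of
  \<open>powr\<close> at 0.\<close>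

lemma C_k_on_powr:
  fixes F :: "'a::real_normed_vector \<Rightarrow> real"
  assumes "\<And>x. x \<in> S \<Longrightarrow> 0 < F x" and "C_k_on k S F"
  shows "C_k_on k S (\<lambda>x. F x powr a)"
  using assms(2)
proof (induction k arbitrary: a)
  case 0
  then show ?case
    using assms(1) by (simp add: continuous_on_powr less_imp_neq[symmetric])
next
  case (Suc k)
  obtain F' where F': "\<forall>x\<in>S. (F has_derivative F' x) (at x within S)"
      "\<forall>v. C_k_on k S (\<lambda>x. F' x v)"
    using Suc.prems by auto
  have "((\<lambda>x. F x powr a) has_derivative (\<lambda>v. a * F x powr (a - 1) * F' x v)) (at x within S)"
    if "x \<in> S" for x
  proof -
    have "((\<lambda>u. u powr a) has_derivative (*) (a * F x powr (a - 1))) (at (F x))"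
      using has_real_derivative_powr[of "F x" a] assms(1)[OF that]
      by (simp add: has_field_derivative_def)
    from has_derivative_compose[OF F'(1)[rule_format, OF that] this] show ?thesis .
  qed
  moreover have "C_k_on k S (\<lambda>x. a * F x powr (a - 1) * F' x v)" for v
    by (intro C_k_on_mult C_k_on_const Suc.IH C_k_on_Suc_D[OF Suc.prems] F'(2)[rule_format])
  ultimately show ?case
    by (rule C_k_on_SucI)
qed

section \<open>The flat exponential and its derivatives\<close>

text \<open>\<open>flat 0\<close> is the standard smooth function that is flat at 0. The index
  \<open>m\<close> adds a negative power of \<open>u\<close>, so that the linear span of the family
  is closed under differentiation.\<close>

definition flat :: "nat \<Rightarrow> real \<Rightarrow> real" where
  "flat m u = (if u \<le> 0 then 0 else exp (- 1 / u) / u ^ m)"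

lemma flat_nonneg: "0 \<le> flat m u"
  by (simp add: flat_def)

text \<open>On the right, substituting \<open>v = inverse u\<close> gives
  \<open>v ^ m / exp v\<close> with \<open>v\<close> tending to infinity; on the left the function
  is identically 0.\<close>

lemma flat_0_tendsto: "(flat m \<longlongrightarrow> 0) (at 0)"
proof -
  have "filterlim (\<lambda>u::real. inverse u) at_top (at_right 0)"
    by (rule filterlim_inverse_at_top_right)
  from filterlim_compose[OF tendsto_power_div_exp_0 this]
  have "((\<lambda>u. inverse u ^ m / exp (inverse u)) \<longlongrightarrow> 0) (at_right (0::real))" .
  then have "(flat m \<longlongrightarrow> 0) (at_right 0)"
    by (rule Lim_transform_eventually)
      (auto simp: eventually_at_right_less flat_def exp_minus field_simps
        intro!: eventually_mono[OF eventually_at_right_less[of 0]])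
  moreover have "(flat m \<longlongrightarrow> 0) (at_left 0)"
    by (rule tendsto_eventually) (auto simp: eventually_at_left_field flat_def intro: exI[of _ "-1"])
  ultimately show ?thesis
    by (simp add: filterlim_at_split)
qed

lemma flat_has_real_derivative:
  "(flat m has_real_derivative flat (m + 2) u - real m * flat (m + 1) u) (at u)"
proof -
  consider "u < 0" | "u = 0" | "0 < u" by linarith
  then show ?thesis
  proof cases
    case 1
    have "((\<lambda>u. 0) has_real_derivative 0) (at u)" by simp
    then have "(flat m has_real_derivative 0) (at u)"
      by (rule has_field_derivative_transform_within_open[of _ _ _ "{..<0}"])
        (use 1 in \<open>auto simp: flat_def\<close>)
    then show ?thesis using 1 by (simp add: flat_def)
  next
    case 2
    \<comment> \<open>Dividing by \<open>h\<close> only raises the index, so the difference quotient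
      at 0 is again a member of the family and tends to 0.\<close>
    have "(\<lambda>h. (flat m (0 + h) - flat m 0) / h) = flat (m + 1)"
      by (auto simp: flat_def fun_eq_iff)
    then show ?thesis
      using flat_0_tendsto[of "m + 1"] unfolding 2 DERIV_def by (simp add: flat_def)
  next
    case 3
    \<comment> \<open>This removes the truncated exponent of the power rule; for
      \<open>m = 0\<close> the factor \<open>real m\<close> makes both sides 0.\<close>
    have "real m * u ^ (m - Suc 0) = real m * u ^ m / u"
      using 3 by (cases m) auto
    then have "((\<lambda>u. exp (- 1 / u) / u ^ m) has_real_derivative
        flat (m + 2) u - real m * flat (m + 1) u) (at u)"
      using 3 by (auto intro!: derivative_eq_intros simp: flat_def power2_eq_square field_simps)
    then show ?thesis
      by (rule has_field_derivative_transform_within_open[of _ _ _ "{0<..}"])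
        (use 3 in \<open>auto simp: flat_def\<close>)
  qed
qed

lemma flat_derivs:
  "(flat 0 has_real_derivative flat 2 u) (at u)"
  "(flat 2 has_real_derivative flat 4 u - 2 * flat 3 u) (at u)"
  using flat_has_real_derivative[of 0 u] flat_has_real_derivative[of 2 u]
  by (simp_all add: eval_nat_numeral)

lemma continuous_on_flat: "continuous_on S (flat m)"
  by (meson DERIV_isCont continuous_at_imp_continuous_on flat_has_real_derivative)

text \<open>The chain rule turns index \<open>m\<close> into \<open>m + 1\<close> and
  \<open>m + 2\<close>, hence the induction over all indices together.\<close>

lemma C_k_on_flat:
  fixes F :: "'a::real_normed_vector \<Rightarrow> real"
  assumes "C_k_on k S F"
  shows "C_k_on k S (\<lambda>x. flat m (F x))"
  using assms
proof (induction k arbitrary: m)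
  case 0
  then show ?case
    by (simp add: continuous_on_compose2[OF continuous_on_flat[of UNIV]])
next
  case (Suc k)
  obtain F' where F': "\<forall>x\<in>S. (F has_derivative F' x) (at x within S)"
      "\<forall>v. C_k_on k S (\<lambda>x. F' x v)"
    using Suc.prems by auto
  let ?D = "\<lambda>x v. (flat (m + 2) (F x) + (- real m) * flat (m + 1) (F x)) * F' x v"
  have "((\<lambda>x. flat m (F x)) has_derivative ?D x) (at x within S)" if "x \<in> S" for x
  proof -
    have "(flat m has_derivative (*) (flat (m + 2) (F x) + (- real m) * flat (m + 1) (F x))) (at (F x))"
      using flat_has_real_derivative[of m "F x"] by (simp add: has_field_derivative_def)
    from has_derivative_compose[OF F'(1)[rule_format, OF that] this] show ?thesis .
  qed
  moreover have "C_k_on k S (\<lambda>x. ?D x v)" for v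
    by (intro C_k_on_mult C_k_on_add C_k_on_const Suc.IH C_k_on_Suc_D[OF Suc.prems] F'(2)[rule_format])
  ultimately show ?case
    by (rule C_k_on_SucI)
qed

section \<open>The Laplacian of a radial function\<close>

text \<open>Taking \<open>h\<close> as a function of the squared norm avoids the singularity of the
  norm at the origin. The \<open>i\<close>-th second derivative is
  \<open>2 * h' + 4 * h'' * (x $ i)\<^sup>2\<close>, and summing over \<open>i\<close> gives the
  dimension and \<open>x \<bullet> x\<close>.\<close>

lemma laplacian_radial:
  fixes x :: "real ^ 'n::finite"
  assumes "\<And>r. (h has_real_derivative h' r) (at r)"
    and "\<And>r. (h' has_real_derivative h'' r) (at r)"
  shows "laplacian (\<lambda>y. h (y \<bullet> y)) x = 2 * real CARD('n) * h' (x \<bullet> x) + 4 * (x \<bullet> x) * h'' (x \<bullet> x)"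
proof -
  have sq: "((\<lambda>s. (y + s *\<^sub>R axis i 1) \<bullet> (y + s *\<^sub>R axis i 1)) has_real_derivative 2 * y $ i) (at 0)"
    for y :: "real ^ 'n" and i
    by (auto intro!: derivative_eq_intros simp: inner_add_left inner_add_right inner_axis inner_axis_axis
        inner_commute[of "axis i 1"])
  have first: "partial_deriv i (\<lambda>y. h (y \<bullet> y)) = (\<lambda>y. h' (y \<bullet> y) * (2 * y $ i))" for i :: 'n
    unfolding partial_deriv_def
    by (intro ext DERIV_imp_deriv) (use DERIV_chain2[OF assms(1) sq] in simp)
  have h': "((\<lambda>s. h' ((x + s *\<^sub>R axis i 1) \<bullet> (x + s *\<^sub>R axis i 1))) has_real_derivative
      h'' (x \<bullet> x) * (2 * x $ i)) (at 0)" for i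
    using DERIV_chain2[OF assms(2) sq] by simp
  have "partial_deriv i (\<lambda>y. h' (y \<bullet> y) * (2 * y $ i)) x
      = 2 * h' (x \<bullet> x) + 4 * h'' (x \<bullet> x) * (x $ i)\<^sup>2" for i
    unfolding partial_deriv_def
    by (rule DERIV_imp_deriv)
      (auto intro!: derivative_eq_intros h' simp: power2_eq_square)
  then have "laplacian (\<lambda>y. h (y \<bullet> y)) x = (\<Sum>i\<in>UNIV. 2 * h' (x \<bullet> x) + 4 * h'' (x \<bullet> x) * (x $ i)\<^sup>2)"
    by (simp add: laplacian_def first)
  also have "\<dots> = 2 * real CARD('n) * h' (x \<bullet> x) + 4 * h'' (x \<bullet> x) * (\<Sum>i\<in>UNIV. (x $ i)\<^sup>2)"
    by (simp add: sum.distrib sum_distrib_left)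
  also have "(\<Sum>i\<in>UNIV. (x $ i)\<^sup>2) = x \<bullet> x"
    by (simp add: inner_vec_def power2_eq_square)
  finally show ?thesis by simp
qed

section \<open>Scaling invariance of the L^p norm\<close>

lemma lborel_integral_scaleR:
  fixes g :: "'a::euclidean_space \<Rightarrow> real"
  assumes "0 < c" and [measurable]: "g \<in> borel_measurable borel"
  shows "(LINT x|lborel. g x) = c ^ DIM('a) * (LINT x|lborel. g (c *\<^sub>R x))"
  using assms(1)
  by (subst lborel_affine[of c 0]) (auto simp: integral_density integral_distr)

text \<open>The \<open>p\<close>-th power of the prefactor is \<open>c ^ DIM('a)\<close>, exactly
  the Jacobian of the dilation by \<open>c\<close>.\<close>

lemma Lp_norm_scaleR:
  fixes g :: "'a::euclidean_space \<Rightarrow> real"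
  assumes "0 < c" and "p > 0" and [measurable]: "g \<in> borel_measurable borel"
  shows "Lp_norm p (\<lambda>x. c powr (DIM('a) / p) * g (c *\<^sub>R x)) = Lp_norm p g"
proof -
  have "\<bar>c powr (DIM('a) / p) * g (c *\<^sub>R x)\<bar> powr p = c ^ DIM('a) * \<bar>g (c *\<^sub>R x)\<bar> powr p" for x
    using assms(1,2) by (simp add: abs_mult powr_mult powr_powr powr_realpow)
  then show ?thesis
    using lborel_integral_scaleR[OF assms(1), of "\<lambda>x. \<bar>g x\<bar> powr p"] by (simp add: Lp_norm_def)
qed

section \<open>The elliptic inequality for the profile\<close>

text \<open>
  For small \<open>u\<close> the term \<open>4 * (1 - u) * flat 4 u\<close> wins, since \<open>u\<^sup>4 * flat 4 u = flat 0 u\<close>; for \<open>u\<close>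
  bounded away from \<open>0\<close> the large factor \<open>A\<close> does.
\<close>

lemma flat_profile_subsolution:
  assumes "0 < \<alpha>" and "0 \<le> q" and "0 \<le> d"
  shows "\<exists>A>0. \<forall>u\<le>1. q * flat 0 u
    \<le> 4 * (1 - u) * (flat 4 u - 2 * flat 3 u) - 2 * d * flat 2 u + A powr \<alpha> * flat 0 u powr (1 + \<alpha>)"
proof -
  \<comment> \<open>The threshold is chosen so that \<open>u \<le> \<delta>\<close> means
    \<open>12 * u + 2 * d * u + q * u \<le> 4\<close>. Beyond it, \<open>K\<close> bounds all terms
    of unfavourable sign, and \<open>A\<close> is taken so that
    \<open>A powr \<alpha> * exp (- \<alpha> / \<delta>) = K + 1\<close>.\<close>
  define \<delta> where "\<delta> = 4 / (12 + 2 * d + q)"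
  define K where "K = q + 8 / \<delta> ^ 3 + 2 * d / \<delta> ^ 2"
  define A where "A = ((K + 1) * exp (\<alpha> / \<delta>)) powr (1 / \<alpha>)"
  have \<delta>: "\<delta> > 0" using assms by (auto simp: \<delta>_def)
  have K: "K \<ge> 0" using assms \<delta> by (auto simp: K_def)
  have A\<alpha>: "A powr \<alpha> = (K + 1) * exp (\<alpha> / \<delta>)"
    using K assms(1) by (simp add: A_def powr_powr)
  have "A > 0" using K by (simp add: A_def)
  moreover have "q * flat 0 u
    \<le> 4 * (1 - u) * (flat 4 u - 2 * flat 3 u) - 2 * d * flat 2 u + A powr \<alpha> * flat 0 u powr (1 + \<alpha>)"
    if "u \<le> 1" for u
  proof (cases "u \<le> 0")
    case True
    then show ?thesis by (simp add: flat_def)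
  next
    case False
    then have u: "0 < u" by simp
    define e where "e = exp (- 1 / u)"
    have e: "e > 0" by (simp add: e_def)
    have fl: "flat m u = e / u ^ m" for m using u by (simp add: flat_def e_def)
    \<comment> \<open>Every \<open>flat m u\<close> is \<open>e / u ^ m\<close>, so this is the
      claim divided by the positive number \<open>e\<close>.\<close>
    have "q \<le> 4 * (1 - u) * (1 / u ^ 4 - 2 / u ^ 3) - 2 * d / u\<^sup>2 + A powr \<alpha> * e powr \<alpha>"
    proof (cases "u \<le> \<delta>")
      case True
      then have "u * (12 + 2 * d + q) \<le> 4"
        using assms by (simp add: \<delta>_def field_simps)
      \<comment> \<open>After multiplication by \<open>u ^ 4\<close> the inequality is polynomial.
        Since \<open>u \<le> 1\<close>, its higher powers are bounded by \<open>u\<close>, and the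
        choice of \<open>\<delta>\<close> absorbs them into the constant 4.\<close>
      moreover have "q * u ^ 4 \<le> q * u" "2 * d * u\<^sup>2 \<le> 2 * d * u"
        using assms u that power_decreasing[of 1 4 u] power_decreasing[of 1 2 u]
        by (auto intro!: mult_left_mono)
      moreover have "u * (12 + 2 * d + q) = 12 * u + 2 * d * u + q * u"
        "4 * (1 - u) * (1 - 2 * u) = 4 - 12 * u + 8 * u\<^sup>2"
        by (simp_all add: algebra_simps power2_eq_square)
      ultimately have "q * u ^ 4 \<le> 4 * (1 - u) * (1 - 2 * u) - 2 * d * u\<^sup>2"
        using zero_le_power2[of u] by linarith
      then have "q \<le> (4 * (1 - u) * (1 - 2 * u) - 2 * d * u\<^sup>2) / u ^ 4"
        using u by (simp add: pos_le_divide_eq)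
      also have "\<dots> = 4 * (1 - u) * (1 / u ^ 4 - 2 / u ^ 3) - 2 * d / u\<^sup>2"
        using u by (simp add: field_simps eval_nat_numeral)
      also have "\<dots> \<le> \<dots> + A powr \<alpha> * e powr \<alpha>" by simp
      finally show ?thesis .
    next
      case False
      \<comment> \<open>Away from 0 the favourable term \<open>1 / u ^ 4\<close> is dropped, and the
        remaining negative ones are bounded by their coefficients at
        \<open>\<delta>\<close>.\<close>
      have "4 * (1 - u) * (1 / u ^ 4 - 2 / u ^ 3) \<ge> 4 * (1 - u) * (- (2 / u ^ 3))"
        using u that by (intro mult_left_mono) auto
      moreover have "4 * (1 - u) * (2 / u ^ 3) \<le> 4 * 1 * (2 / \<delta> ^ 3)"
        using u \<delta> that False by (intro mult_mono divide_left_mono power_mono) auto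
      moreover have "2 * d / u\<^sup>2 \<le> 2 * d / \<delta>\<^sup>2"
        using u \<delta> assms False by (intro divide_left_mono power_mono) auto
      moreover have "K \<le> A powr \<alpha> * e powr \<alpha>"
      proof -
        have "1 / u \<le> 1 / \<delta>"
          using u \<delta> False by (simp add: frac_le)
        then have "\<alpha> / u \<le> \<alpha> / \<delta>"
          using assms(1) by (metis mult.right_neutral mult_left_mono less_imp_le times_divide_eq_right)
        then have "1 \<le> exp (\<alpha> / \<delta> - \<alpha> / u)" by simp
        then have "K \<le> (K + 1) * exp (\<alpha> / \<delta> - \<alpha> / u)"
          using K mult_mono[of K "K + 1" 1 "exp (\<alpha> / \<delta> - \<alpha> / u)"] by simp
        moreover have "e powr \<alpha> = exp (- (\<alpha> / u))"
          unfolding e_def exp_powr_real by simp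
        then have "(K + 1) * exp (\<alpha> / \<delta> - \<alpha> / u) = A powr \<alpha> * e powr \<alpha>"
          by (simp add: A\<alpha> flip: exp_add)
        ultimately show ?thesis by simp
      qed
      ultimately show ?thesis by (simp add: K_def)
    qed
    then have "e * q \<le> e * (4 * (1 - u) * (1 / u ^ 4 - 2 / u ^ 3) - 2 * d / u\<^sup>2 + A powr \<alpha> * e powr \<alpha>)"
      using e by simp
    also have "\<dots> = 4 * (1 - u) * (e / u ^ 4 - 2 * (e / u ^ 3)) - 2 * d * (e / u\<^sup>2)
        + A powr \<alpha> * (e * e powr \<alpha>)"
      using u by (simp add: field_simps)
    finally show ?thesis
      using e by (simp add: fl powr_add mult_ac)
  qed
  ultimately show ?thesis by blast
qed

section \<open>The self-similar function and its blow-up\<close>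

theorem proposition2p5:
  fixes p \<alpha> :: real
  assumes "1 \<le> p" and "\<alpha> \<ge> 2 * p / real CARD('n::finite)"
  shows "\<exists>f :: real \<Rightarrow> real ^ 'n \<Rightarrow> real.
           (\<forall>t\<in>{0..<1}. \<forall>x. 0 \<le> f t x) \<and>
           (\<forall>t\<in>{0..<1}. \<forall>x. norm x \<ge> 1 \<longrightarrow> f t x = 0) \<and>
           smooth_on ({0..<1} \<times> UNIV) (\<lambda>(t, x). f t x) \<and>
           (\<exists>c. \<forall>t\<in>{0..<1}. Lp_norm p (f t) = c) \<and>
           (\<forall>t\<in>{0..<1}. \<forall>x.
              vector_derivative (\<lambda>s. f s x) (at t within {0..<1})
                \<le> laplacian (f t) x + f t x powr (1 + \<alpha>)) \<and>
           filterlim (\<lambda>t. f t 0) at_top (at_left 1)"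
proof -
  define d where "d = real CARD('n)"
  define q where "q = d / (2 * p)"
  have d: "d > 0" by (simp add: d_def)
  have q: "q > 0" using d assms(1) by (simp add: q_def)
  have \<alpha>: "\<alpha> > 0" using assms d d_def by (smt (verit) divide_pos_pos)
  \<comment> \<open>This is the hypothesis \<open>\<alpha> \<ge> 2 * p / d\<close> rewritten in
    terms of the scaling exponent \<open>q\<close>; it makes the nonlinearity at least as singular
    in time as the linear terms.\<close>
  have q\<alpha>: "q * \<alpha> \<ge> 1"
    using assms d by (simp add: q_def d_def field_simps)
  obtain A where A: "A > 0" and sub: "\<And>u. u \<le> 1 \<Longrightarrow> q * flat 0 u
    \<le> 4 * (1 - u) * (flat 4 u - 2 * flat 3 u) - 2 * d * flat 2 u + A powr \<alpha> * flat 0 u powr (1 + \<alpha>)"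
    using flat_profile_subsolution[of \<alpha> q d] \<alpha> q d by auto
  \<comment> \<open>Only the squared norm enters, so no square root is needed, and
    \<open>flat 0\<close> supplies the cutoff. Division by \<open>1 - t\<close> is written as a
    power so that \<open>C_k_on_powr\<close> covers it.\<close>
  define f where "f = (\<lambda>t (x :: real ^ 'n). A * (1 - t) powr (- q) * flat 0 (1 - (x \<bullet> x) * (1 - t) powr (- 1)))"

  have nonneg: "0 \<le> f t x" for t x
    using A by (simp add: f_def flat_nonneg)

  have supp: "f t x = 0" if "t \<in> {0..<1}" "norm x \<ge> 1" for t x
  proof -
    \<comment> \<open>The argument of \<open>flat 0\<close> is nonpositive as soon as
      \<open>x \<bullet> x \<ge> 1 - t\<close>, and \<open>1 - t \<le> 1\<close>: the support
      shrinks to the origin inside the unit ball.\<close>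
    have "1 - t \<le> x \<bullet> x"
      using that by (simp add: dot_square_norm) (smt (verit) one_le_power)
    then show ?thesis
      using that by (simp add: f_def flat_def powr_minus field_simps)
  qed

  have smooth: "smooth_on ({0..<1} \<times> UNIV) (\<lambda>(t, x). f t x)"
  proof -
    let ?S = "{0..<1::real} \<times> (UNIV :: (real ^ 'n) set)"
    have time: "C_k_on k ?S (\<lambda>z. (1 - fst z) powr a)" for k a
    proof (rule C_k_on_powr)
      \<comment> \<open>Differences are written as sums with a factor \<open>- 1\<close>, so that
        the rules for sums and products apply.\<close>
      have "C_k_on k ?S (\<lambda>z. 1 + (- 1) * fst z)"
        by (intro C_k_on_add C_k_on_mult C_k_on_const C_k_on_bounded_linear[OF bounded_linear_fst])
      then show "C_k_on k ?S (\<lambda>z. 1 - fst z)" by simp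
    qed auto
    have "C_k_on k ?S (\<lambda>z. A * (1 - fst z) powr (- q)
        * flat 0 (1 + (- 1) * ((snd z \<bullet> snd z) * (1 - fst z) powr (- 1))))" for k
      by (intro C_k_on_mult C_k_on_add C_k_on_const C_k_on_flat C_k_on_inner_self[OF bounded_linear_snd] time)
    then show ?thesis
      by (simp add: smooth_on_def f_def case_prod_unfold)
  qed

  have norm: "Lp_norm p (f t) = Lp_norm p (f 0)" if "t \<in> {0..<1}" for t
  proof -
    \<comment> \<open>\<open>f t\<close> is \<open>f 0\<close> dilated by \<open>c\<close>. The
      exponent \<open>q = d / (2 * p)\<close> is the one for which \<open>(1 - t) powr (- q)\<close>
      equals the normalising factor \<open>c powr (d / p)\<close>.\<close>
    define c where "c = (1 - t) powr (- 1 / 2)"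
    have c: "c > 0" using that by (simp add: c_def)
    have c2: "c\<^sup>2 = (1 - t) powr (- 1)"
      by (simp only: c_def power2_eq_square flip: powr_add) simp
    have "(c *\<^sub>R x) \<bullet> (c *\<^sub>R x) = (x \<bullet> x) * (1 - t) powr (- 1)" for x :: "real ^ 'n"
      unfolding c2[symmetric] by (simp add: power2_eq_square)
    moreover have "c powr (DIM(real ^ 'n) / p) = (1 - t) powr (- q)"
      using assms(1) by (simp add: c_def powr_powr q_def d_def)
    ultimately have "f t = (\<lambda>x. c powr (DIM(real ^ 'n) / p) * f 0 (c *\<^sub>R x))"
      by (simp add: f_def fun_eq_iff)
    moreover have "f 0 \<in> borel_measurable borel"
    proof -
      have "continuous_on UNIV (\<lambda>x :: real ^ 'n. flat 0 (1 - x \<bullet> x))"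
        by (rule continuous_on_compose2[OF continuous_on_flat[of UNIV]]) (auto intro!: continuous_intros)
      then show ?thesis
        by (auto simp: f_def intro!: borel_measurable_continuous_onI continuous_on_mult)
    qed
    ultimately show ?thesis
      using Lp_norm_scaleR[of c p "f 0"] c assms(1) by simp
  qed

  have ineq: "vector_derivative (\<lambda>s. f s x) (at t within {0..<1})
                \<le> laplacian (f t) x + f t x powr (1 + \<alpha>)" if t: "t \<in> {0..<1}" for t x
  proof -
    \<comment> \<open>In the self-similar variable \<open>u\<close>, with
      \<open>x \<bullet> x = (1 - u) * \<tau>\<close>, the time derivative and the Laplacian are
      both \<open>B\<close> times a function of \<open>u\<close> alone.\<close>
    define \<tau> where "\<tau> = 1 - t"
    define u where "u = 1 - (x \<bullet> x) / \<tau>"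
    define B where "B = A * \<tau> powr (- q - 1)"
    have \<tau>: "0 < \<tau>" "\<tau> \<le> 1" using t by (auto simp: \<tau>_def)
    have \<tau>q: "\<tau> powr (- q) = \<tau> powr (- q - 1) * \<tau>"
      using \<tau> by (simp add: powr_diff)
    have u: "u \<le> 1" "x \<bullet> x = (1 - u) * \<tau>" using \<tau> by (auto simp: u_def)
    have f_eq: "f t y = A * \<tau> powr (- q) * flat 0 (1 - (y \<bullet> y) / \<tau>)" for y
      using \<tau> by (simp add: f_def \<tau>_def powr_minus_divide)

    have "((\<lambda>s. f s x) has_real_derivative B * (q * flat 0 u - (1 - u) * flat 2 u)) (at t)"
    proof -
      have pw: "((\<lambda>s. (1 - s) powr a) has_real_derivative - a * \<tau> powr (a - 1)) (at t)" for a
        using \<tau> by (auto intro!: derivative_eq_intros simp: \<tau>_def)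
      have arg: "1 - (x \<bullet> x) * (1 - t) powr (- 1) = u"
        using \<tau> by (simp add: u_def \<tau>_def powr_minus_divide)
      have "((\<lambda>s. 1 - (x \<bullet> x) * (1 - s) powr (- 1)) has_real_derivative
          - ((x \<bullet> x) * \<tau> powr (- 2))) (at t)"
        using DERIV_diff[OF DERIV_const DERIV_cmult[OF pw[of "- 1"], of "x \<bullet> x"], of 1] by simp
      from DERIV_chain2[OF flat_derivs(1) this]
      have "((\<lambda>s. flat 0 (1 - (x \<bullet> x) * (1 - s) powr (- 1))) has_real_derivative
          flat 2 u * - ((x \<bullet> x) * \<tau> powr (- 2))) (at t)"
        unfolding arg .
      from DERIV_mult[OF DERIV_cmult[OF pw[of "- q"], of A] this]
      have f': "((\<lambda>s. f s x) has_real_derivative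
          A * (q * \<tau> powr (- q - 1)) * flat 0 u
          + flat 2 u * - ((x \<bullet> x) * \<tau> powr (- 2)) * (A * \<tau> powr (- q))) (at t)"
        unfolding f_def arg by (simp only: minus_minus \<tau>_def)
      have \<tau>2: "\<tau> powr (- 2) = 1 / \<tau>\<^sup>2"
        using \<tau> by (simp add: powr_minus_divide)
      have "A * (q * \<tau> powr (- q - 1)) * flat 0 u
          + flat 2 u * - ((x \<bullet> x) * \<tau> powr (- 2)) * (A * \<tau> powr (- q))
          = B * (q * flat 0 u - (1 - u) * flat 2 u)"
        unfolding u(2) B_def \<tau>q \<tau>2 using \<tau>
        by (simp add: field_simps power2_eq_square)
      from f'[unfolded this] show ?thesis .
    qed
    \<comment> \<open>The formula for \<open>f\<close> also makes sense for negative times, so the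
      two-sided derivative restricts to the one-sided one at \<open>t = 0\<close>.\<close>
    then have "((\<lambda>s. f s x) has_vector_derivative B * (q * flat 0 u - (1 - u) * flat 2 u))
        (at t within {0..<1})"
      unfolding has_real_derivative_iff_has_vector_derivative
      by (rule has_vector_derivative_at_within)
    moreover have "at t within {0..<1} \<noteq> bot"
      using t by (simp add: trivial_limit_within)
    ultimately have dt: "vector_derivative (\<lambda>s. f s x) (at t within {0..<1})
        = B * (q * flat 0 u - (1 - u) * flat 2 u)"
      by (simp add: vector_derivative_within)

    have lap: "laplacian (f t) x = B * (4 * (1 - u) * (flat 4 u - 2 * flat 3 u) - 2 * d * flat 2 u)"
    proof -
      \<comment> \<open>Each derivative in \<open>r\<close> brings a factor
        \<open>- 1 / \<tau>\<close>. The second-order term regains one \<open>\<tau>\<close> from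
        \<open>x \<bullet> x\<close>, so both terms carry
        \<open>\<tau> powr (- q - 1)\<close>.\<close>
      let ?C = "A * \<tau> powr (- q)"
      let ?h = "\<lambda>r. ?C * flat 0 (1 - r / \<tau>)"
      let ?h' = "\<lambda>r. ?C * (flat 2 (1 - r / \<tau>) * (- 1 / \<tau>))"
      let ?h'' = "\<lambda>r. ?C * ((flat 4 (1 - r / \<tau>) - 2 * flat 3 (1 - r / \<tau>)) * (- 1 / \<tau>) * (- 1 / \<tau>))"
      have lin: "((\<lambda>r. 1 - r / \<tau>) has_real_derivative - 1 / \<tau>) (at r)" for r
        using \<tau> by (auto intro!: derivative_eq_intros)
      have "(?h has_real_derivative ?h' r) (at r)" for r
        by (intro DERIV_cmult DERIV_chain2[OF flat_derivs(1) lin])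
      moreover have "(?h' has_real_derivative ?h'' r) (at r)" for r
        by (intro DERIV_cmult DERIV_cmult_right DERIV_chain2[OF flat_derivs(2) lin])
      ultimately have "laplacian (\<lambda>y. ?h (y \<bullet> y)) x
          = 2 * real CARD('n) * ?h' (x \<bullet> x) + 4 * (x \<bullet> x) * ?h'' (x \<bullet> x)"
        by (rule laplacian_radial)
      also have "\<dots> = B * (4 * (1 - u) * (flat 4 u - 2 * flat 3 u) - 2 * d * flat 2 u)"
        using \<tau> unfolding u_def[symmetric] u(2) B_def \<tau>q d_def[symmetric]
        by (simp add: field_simps)
      finally have "laplacian (\<lambda>y. ?h (y \<bullet> y)) x
          = B * (4 * (1 - u) * (flat 4 u - 2 * flat 3 u) - 2 * d * flat 2 u)" .
      moreover have "f t = (\<lambda>y. ?h (y \<bullet> y))"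
        by (rule ext) (rule f_eq)
      ultimately show ?thesis by (simp only:)
    qed

    have pow: "B * (A powr \<alpha> * flat 0 u powr (1 + \<alpha>)) \<le> f t x powr (1 + \<alpha>)"
    proof -
      have "f t x powr (1 + \<alpha>) = A powr (1 + \<alpha>) * \<tau> powr (- q * (1 + \<alpha>)) * flat 0 u powr (1 + \<alpha>)"
        using A flat_nonneg[of 0 u] unfolding f_eq u_def[symmetric]
        by (simp add: powr_mult powr_powr)
      \<comment> \<open>As \<open>\<tau> \<le> 1\<close>, the more negative exponent gives the
        larger power, and \<open>q * \<alpha> \<ge> 1\<close> orders the exponents.\<close>
      moreover have "\<tau> powr (- q - 1) \<le> \<tau> powr (- q * (1 + \<alpha>))"
        using \<tau> q\<alpha> by (intro powr_mono') (auto simp: algebra_simps)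
      ultimately show ?thesis
        using A by (auto simp: B_def powr_add intro!: mult_right_mono mult_left_mono)
    qed

    \<comment> \<open>The drift term \<open>- (1 - u) * flat 2 u\<close> is nonpositive because
      \<open>u \<le> 1\<close>; what remains is the profile inequality.\<close>
    have "B * (q * flat 0 u - (1 - u) * flat 2 u) \<le> B * (q * flat 0 u)"
      using A u flat_nonneg[of 2 u] by (intro mult_left_mono) (auto simp: B_def)
    also have "\<dots> \<le> B * (4 * (1 - u) * (flat 4 u - 2 * flat 3 u) - 2 * d * flat 2 u
        + A powr \<alpha> * flat 0 u powr (1 + \<alpha>))"
      using sub[OF u(1)] A by (intro mult_left_mono) (auto simp: B_def)
    finally show ?thesis
      using pow unfolding dt lap by (simp add: distrib_left)
  qed

  \<comment> \<open>At the origin the argument of \<open>flat 0\<close> is 1 for all times, so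
    \<open>f t 0 = A * exp (- 1) * (1 - t) powr (- q)\<close>, and \<open>q > 0\<close> gives the
    blow-up.\<close>
  have "filterlim (\<lambda>t. f t 0) at_top (at_left 1)"
  proof -
    have "filterlim (\<lambda>t::real. 1 - t) (at_right 0) (at_left 1)"
      by (auto simp: filterlim_at eventually_at_left_field intro!: tendsto_eq_intros exI[of _ 0])
    then have "filterlim (\<lambda>t. (1 - t) powr (- q)) at_top (at_left (1::real))"
    proof (rule filterlim_compose[rotated])
      have "filterlim (\<lambda>u. - ln u :: real) at_top (at_right 0)"
        using ln_at_0 by (simp add: filterlim_uminus_at_top)
      then have "filterlim (\<lambda>u. exp (q * - ln u)) at_top (at_right 0)"
        using q by (intro filterlim_compose[OF exp_at_top]
            filterlim_tendsto_pos_mult_at_top[OF tendsto_const])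
      then show "filterlim (\<lambda>u. u powr (- q)) at_top (at_right (0::real))"
        by (rule filterlim_mono_eventually)
          (auto simp: powr_def intro!: eventually_mono[OF eventually_at_right_less[of 0]])
    qed
    then have "filterlim (\<lambda>t. A * exp (- 1) * (1 - t) powr (- q)) at_top (at_left 1)"
      using A by (intro filterlim_tendsto_pos_mult_at_top[OF tendsto_const]) auto
    then show ?thesis
      by (simp add: f_def flat_def mult_ac)
  qed
  with nonneg supp smooth norm ineq show ?thesis
    by (intro exI[of _ f]) blast
qed

end
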